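(* Let $S$ be an ordered semigroup. Then $S$ is a nil extension of a left simple and right regular ordered semigroup (i.e. there is an ideal $K$ of $S$ such that $K$ is a left simple and right regular ordered semigroup and $S$ is a nil extension of $K$) if and only if both of the following hold: (1) for all $a,b\in S$ there exists $n\in\mathbb{N}$ such that $a^{n}\in (a^{2n}Sb]$; (2) for all $a\in S$ and all $b\in \mathbf{R}Reg_\leq(S)$, if $a\leq ba$ then $a\leq a^{2}x$ for some $x\in S$.
   Context: An ordered semigroup $(S,\cdot,\leq)$ is a (nonempty) semigroup with a partial order such that $a\leq b$ implies $xa\leq xb$ and $ax\leq bx$ for all $x\in S$. $\mathbb{N}$ is the set of positive integers. For $H\subseteq S$, $(H]=\{t\in S: t\leq h \text{ for some } h\in H\}$. A nonempty subset $I\subseteq S$ is a left (right) ideal if $SI\subseteq I$ ($IS\subseteq I$) and $(I]=I$; it is an ideal if it is both. Ideals and subsemigroups of $S$ are regarded as ordered semigroups with the induced operation and order. $S$ is left simple if it has no left ideal other than $S$ itself. For an ideal $I$ of $S$, $S$ is called a nil extension of $I$ if for every $a\in S$ there is $m\in\mathbb{N}$ with $a^m\in I$ (equivalently, the Rees factor ordered semigroup $S/I$ is nil). An element $a\in S$ is right regular if $a\leq a^2x$ for some $x\in S$; $\mathbf{R}Reg_\leq(S)$ is the set of right regular elements of $S$. An ordered semigroup is right regular if all its elements are right regular in it. *)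

theory Defs
  imports Main
begin

text \<open>
  An ordered semigroup is given by a carrier \<open>S\<close>, a multiplication and an order, the latter two
  being constrained on \<open>S\<close> only. A subset \<open>K\<close> of \<open>S\<close> with the induced operation and order is
  therefore the structure with carrier \<open>K\<close> and the same \<open>mult\<close> and \<open>le\<close>.
\<close>

locale ordered_semigroup =
  fixes S :: "'a set"
    and mult :: "'a \<Rightarrow> 'a \<Rightarrow> 'a"
    and le :: "'a \<Rightarrow> 'a \<Rightarrow> bool"
  assumes nonempty: "S \<noteq> {}"
    and closed: "\<lbrakk>a \<in> S; b \<in> S\<rbrakk> \<Longrightarrow> mult a b \<in> S"
    and assoc: "\<lbrakk>a \<in> S; b \<in> S; c \<in> S\<rbrakk> \<Longrightarrow> mult (mult a b) c = mult a (mult b c)"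
    and le_refl: "reflp_on S le"
    and le_antisym: "antisymp_on S le"
    and le_trans: "transp_on S le"
    and mult_mono_left: "\<lbrakk>a \<in> S; b \<in> S; x \<in> S; le a b\<rbrakk> \<Longrightarrow> le (mult x a) (mult x b)"
    and mult_mono_right: "\<lbrakk>a \<in> S; b \<in> S; x \<in> S; le a b\<rbrakk> \<Longrightarrow> le (mult a x) (mult b x)"

definition set_prod :: "('a \<Rightarrow> 'a \<Rightarrow> 'a) \<Rightarrow> 'a set \<Rightarrow> 'a set \<Rightarrow> 'a set" where
  "set_prod mult A B = {mult a b | a b. a \<in> A \<and> b \<in> B}"

text \<open>
  A semigroup has no unit, so only exponents \<open>n > 0\<close> are meaningful;
  the value at \<open>n = 0\<close> is junk.
\<close>

definition spow :: "('a \<Rightarrow> 'a \<Rightarrow> 'a) \<Rightarrow> 'a \<Rightarrow> nat \<Rightarrow> 'a" where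
  "spow mult a n = ((\<lambda>x. mult x a) ^^ (n - 1)) a"

text \<open>The set \<open>(H]\<close>, formed in \<open>S\<close>.\<close>

definition down :: "'a set \<Rightarrow> ('a \<Rightarrow> 'a \<Rightarrow> bool) \<Rightarrow> 'a set \<Rightarrow> 'a set" where
  "down S le H = {t \<in> S. \<exists>h\<in>H. le t h}"

definition left_ideal ::
    "'a set \<Rightarrow> ('a \<Rightarrow> 'a \<Rightarrow> 'a) \<Rightarrow> ('a \<Rightarrow> 'a \<Rightarrow> bool) \<Rightarrow> 'a set \<Rightarrow> bool" where
  "left_ideal S mult le I \<longleftrightarrow>
     I \<noteq> {} \<and> I \<subseteq> S \<and> set_prod mult S I \<subseteq> I \<and> down S le I = I"

definition right_ideal ::
    "'a set \<Rightarrow> ('a \<Rightarrow> 'a \<Rightarrow> 'a) \<Rightarrow> ('a \<Rightarrow> 'a \<Rightarrow> bool) \<Rightarrow> 'a set \<Rightarrow> bool" where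
  "right_ideal S mult le I \<longleftrightarrow>
     I \<noteq> {} \<and> I \<subseteq> S \<and> set_prod mult I S \<subseteq> I \<and> down S le I = I"

definition two_sided_ideal ::
    "'a set \<Rightarrow> ('a \<Rightarrow> 'a \<Rightarrow> 'a) \<Rightarrow> ('a \<Rightarrow> 'a \<Rightarrow> bool) \<Rightarrow> 'a set \<Rightarrow> bool" where
  "two_sided_ideal S mult le I \<longleftrightarrow> left_ideal S mult le I \<and> right_ideal S mult le I"

definition left_simple ::
    "'a set \<Rightarrow> ('a \<Rightarrow> 'a \<Rightarrow> 'a) \<Rightarrow> ('a \<Rightarrow> 'a \<Rightarrow> bool) \<Rightarrow> bool" where
  "left_simple S mult le \<longleftrightarrow> (\<forall>I. left_ideal S mult le I \<longrightarrow> I = S)"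

definition nil_extension ::
    "'a set \<Rightarrow> ('a \<Rightarrow> 'a \<Rightarrow> 'a) \<Rightarrow> ('a \<Rightarrow> 'a \<Rightarrow> bool) \<Rightarrow> 'a set \<Rightarrow> bool" where
  "nil_extension S mult le I \<longleftrightarrow>
     two_sided_ideal S mult le I \<and> (\<forall>a\<in>S. \<exists>m>0. spow mult a m \<in> I)"

definition RReg ::
    "'a set \<Rightarrow> ('a \<Rightarrow> 'a \<Rightarrow> 'a) \<Rightarrow> ('a \<Rightarrow> 'a \<Rightarrow> bool) \<Rightarrow> 'a set" where
  "RReg S mult le = {a \<in> S. \<exists>x\<in>S. le a (mult (spow mult a 2) x)}"

definition right_regular ::
    "'a set \<Rightarrow> ('a \<Rightarrow> 'a \<Rightarrow> 'a) \<Rightarrow> ('a \<Rightarrow> 'a \<Rightarrow> bool) \<Rightarrow> bool" where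
  "right_regular S mult le \<longleftrightarrow> (\<forall>a\<in>S. a \<in> RReg S mult le)"

end

theory Submission
  imports Defs
begin

text \<open>
  The ideal \<open>K\<close> of the theorem is forced: it has to be the set \<open>R\<close> of right regular elements
  of \<open>S\<close>, and this set is at the same time the least left ideal of \<open>S\<close>.

  If \<open>S\<close> is a nil extension of a left simple, right regular \<open>K\<close>, take \<open>c = a\<^sup>m \<in> K\<close>. Right
  regularity gives \<open>c \<le> c\<^sup>2 x\<close> with \<open>x \<in> K\<close>, and left simplicity bounds \<open>x\<close> by a left
  multiple of \<open>c b \<in> K\<close>, hence of \<open>b\<close>; this is the condition on powers. For the other one,
  \<open>a \<le> b a\<close> iterates to \<open>a \<le> b\<^sup>m a\<close>, and \<open>b\<^sup>m \<in> K\<close> pulls \<open>a\<close> into \<open>K\<close>.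

  Conversely, assume both conditions. The first puts some power of every element into \<open>R\<close>. Two
  facts determine \<open>R\<close>. From \<open>e \<le> e\<^sup>2 x\<close> one gets, for every \<open>n\<close>, some \<open>u\<close> with \<open>e \<le> u x\<^sup>n\<close>, so
  the first condition, applied to the \<^emph>\<open>witness\<close> \<open>x\<close> instead of \<open>e\<close>, shows that \<open>e\<close> lies below a
  left multiple of any given \<open>b\<close> (\<open>RReg_below_left_multiple\<close>). And \<open>a \<le> s a\<close> for some \<open>s\<close> implies
  \<open>a \<in> R\<close>, because \<open>s\<close> may be replaced by a power of it that lies in \<open>R\<close>, and then the second
  condition applies (\<open>left_absorbed_in_RReg\<close>). Thus \<open>a \<in> R\<close> if and only if \<open>a \<le> s a\<close> for some
  \<open>s\<close>, if and only if \<open>a\<close> is below a left multiple of every element. The first form makes \<open>R\<close>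
  closed under right multiplication, the second makes it a left ideal contained in all others.
\<close>

section \<open>Powers and ideals in ordered semigroups\<close>

lemma mem_down_set_prod:
  "t \<in> down S le (set_prod mult A {b}) \<longleftrightarrow> t \<in> S \<and> (\<exists>u\<in>A. le t (mult u b))"
  unfolding down_def set_prod_def by auto

lemma mem_down_set_prod2:
  "t \<in> down S le (set_prod mult (set_prod mult {c} A) {b})
    \<longleftrightarrow> t \<in> S \<and> (\<exists>s\<in>A. le t (mult (mult c s) b))"
  unfolding down_def set_prod_def by auto

lemma spow_one [simp]: "spow mult a (Suc 0) = a"
  by (simp add: spow_def)

lemma spow_Suc: "n > 0 \<Longrightarrow> spow mult a (Suc n) = mult (spow mult a n) a"
  by (cases n) (simp_all add: spow_def)

lemma spow_2: "spow mult a 2 = mult a a"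
  by (simp add: numeral_2_eq_2 spow_Suc)

lemma left_idealI:
  assumes "reflp_on S le" "I \<noteq> {}" "I \<subseteq> S"
    and "\<And>s x. s \<in> S \<Longrightarrow> x \<in> I \<Longrightarrow> mult s x \<in> I"
    and "\<And>t x. t \<in> S \<Longrightarrow> x \<in> I \<Longrightarrow> le t x \<Longrightarrow> t \<in> I"
  shows "left_ideal S mult le I"
  using assms unfolding left_ideal_def set_prod_def down_def
  by (auto dest: reflp_onD)

lemma right_idealI:
  assumes "reflp_on S le" "I \<noteq> {}" "I \<subseteq> S"
    and "\<And>s x. s \<in> S \<Longrightarrow> x \<in> I \<Longrightarrow> mult x s \<in> I"
    and "\<And>t x. t \<in> S \<Longrightarrow> x \<in> I \<Longrightarrow> le t x \<Longrightarrow> t \<in> I"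
  shows "right_ideal S mult le I"
  using assms unfolding right_ideal_def set_prod_def down_def
  by (auto dest: reflp_onD)

lemma left_idealD:
  assumes "left_ideal S mult le I"
  shows "I \<noteq> {}" "I \<subseteq> S"
    and "\<And>s x. s \<in> S \<Longrightarrow> x \<in> I \<Longrightarrow> mult s x \<in> I"
    and "\<And>t x. t \<in> S \<Longrightarrow> x \<in> I \<Longrightarrow> le t x \<Longrightarrow> t \<in> I"
  using assms unfolding left_ideal_def set_prod_def down_def by blast+

lemma right_ideal_mult:
  assumes "right_ideal S mult le I" "x \<in> I" "s \<in> S"
  shows "mult x s \<in> I"
  using assms unfolding right_ideal_def set_prod_def by blast

context ordered_semigroup
begin

lemma le_transD: "le a b \<Longrightarrow> le b c \<Longrightarrow> a \<in> S \<Longrightarrow> b \<in> S \<Longrightarrow> c \<in> S \<Longrightarrow> le a c"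
  using le_trans by (auto dest: transp_onD)

lemma spow_closed:
  assumes "a \<in> S"
  shows "spow mult a n \<in> S"
proof -
  have "((\<lambda>x. mult x a) ^^ k) a \<in> S" for k
    using assms by (induction k) (auto intro: closed)
  then show ?thesis
    by (simp add: spow_def)
qed

lemma spow_add:
  assumes "a \<in> S" "m > 0" "n > 0"
  shows "spow mult a (m + n) = mult (spow mult a m) (spow mult a n)"
  using \<open>n > 0\<close>
proof (induction n rule: nat_induct_non_zero)
  case 1
  then show ?case
    using assms by (simp add: spow_Suc)
next
  case (Suc n)
  then show ?case
    using assms by (simp add: spow_Suc assoc spow_closed)
qed

lemma spow_double:
  assumes "a \<in> S" "n > 0"
  shows "spow mult a (2 * n) = mult (spow mult a n) (spow mult a n)"
  using spow_add[OF assms(1,2,2)] by (simp add: mult_2)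

lemma RReg_iff:
  "a \<in> RReg S mult le \<longleftrightarrow> a \<in> S \<and> (\<exists>x\<in>S. le a (mult (mult a a) x))"
  by (simp add: RReg_def spow_2)

lemma le_spow_mult:
  assumes "a \<in> S" "b \<in> S" "le a (mult b a)" "n > 0"
  shows "le a (mult (spow mult b n) a)"
  using \<open>n > 0\<close>
proof (induction n rule: nat_induct_non_zero)
  case 1
  then show ?case
    using assms by simp
next
  case (Suc n)
  have "le (mult (spow mult b n) a) (mult (spow mult b n) (mult b a))"
    using assms by (intro mult_mono_left) (auto simp: closed spow_closed)
  moreover have "mult (spow mult b n) (mult b a) = mult (spow mult b (Suc n)) a"
    using assms Suc.hyps by (simp add: spow_Suc assoc spow_closed)
  ultimately have "le (mult (spow mult b n) a) (mult (spow mult b (Suc n)) a)"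
    by simp
  with Suc.IH show ?case
    by (rule le_transD) (use assms in \<open>simp_all add: closed spow_closed\<close>)
qed

text \<open>
  Substituting the inequality into the second factor of \<open>a\<^sup>2 x = a (a x)\<close> produces one more
  factor \<open>x\<close> on the right each time.
\<close>

lemma le_mult_spow_witness:
  assumes "a \<in> S" "x \<in> S" "le a (mult (mult a a) x)" "n > 0"
  shows "\<exists>u\<in>S. le a (mult u (spow mult x n))"
  using \<open>n > 0\<close>
proof (induction n rule: nat_induct_non_zero)
  case 1
  then show ?case
    using assms by (intro bexI[of _ "mult a a"]) (simp_all add: closed)
next
  case (Suc n)
  then obtain u where u: "u \<in> S" "le a (mult u (spow mult x n))"
    by blast
  let ?p = "spow mult x n"
  have p: "?p \<in> S"
    using assms by (simp add: spow_closed)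
  have "le (mult (mult a a) x) (mult (mult a (mult u ?p)) x)"
    using assms u p by (intro mult_mono_right mult_mono_left) (auto simp: closed)
  moreover have "mult (mult a (mult u ?p)) x = mult (mult a u) (spow mult x (Suc n))"
    using assms u p Suc.hyps by (simp add: spow_Suc assoc closed)
  ultimately have "le (mult (mult a a) x) (mult (mult a u) (spow mult x (Suc n)))"
    by simp
  with assms(3) have "le a (mult (mult a u) (spow mult x (Suc n)))"
    by (rule le_transD) (use assms u in \<open>simp_all add: closed spow_closed\<close>)
  then show ?case
    using closed[OF assms(1) u(1)] by blast
qed

text \<open>The set \<open>(Sb]\<close>: in a left simple ordered semigroup it has to be everything.\<close>

lemma left_ideal_left_multiples:
  assumes "b \<in> S"
  shows "left_ideal S mult le (down S le (set_prod mult S {b}))"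
proof (rule left_idealI)
  have "mult b b \<in> down S le (set_prod mult S {b})"
    using assms closed[OF assms assms] reflp_onD[OF le_refl] unfolding mem_down_set_prod by blast
  then show "down S le (set_prod mult S {b}) \<noteq> {}"
    by blast
next
  fix s t
  assume s: "s \<in> S" and "t \<in> down S le (set_prod mult S {b})"
  then obtain u where t: "t \<in> S" and u: "u \<in> S" "le t (mult u b)"
    by (auto simp: mem_down_set_prod)
  have "le (mult s t) (mult s (mult u b))"
    using s t u assms by (intro mult_mono_left) (auto simp: closed)
  then have "le (mult s t) (mult (mult s u) b)"
    using s u assms by (simp add: assoc)
  then show "mult s t \<in> down S le (set_prod mult S {b})"
    using s t u by (auto simp: mem_down_set_prod closed)
next
  fix t x
  assume t: "t \<in> S" "le t x" and "x \<in> down S le (set_prod mult S {b})"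
  then obtain u where u: "x \<in> S" "u \<in> S" "le x (mult u b)"
    by (auto simp: mem_down_set_prod)
  have "le t (mult u b)"
    using t(2) u(3) by (rule le_transD) (use t u assms in \<open>simp_all add: closed\<close>)
  then show "t \<in> down S le (set_prod mult S {b})"
    using t u by (auto simp: mem_down_set_prod)
qed (auto simp: le_refl mem_down_set_prod)

lemma left_simple_le_left_multiple:
  assumes "left_simple S mult le" "a \<in> S" "b \<in> S"
  shows "\<exists>u\<in>S. le a (mult u b)"
proof -
  have "down S le (set_prod mult S {b}) = S"
    using assms left_ideal_left_multiples unfolding left_simple_def by blast
  with assms(2) have "a \<in> down S le (set_prod mult S {b})"
    by simp
  then show ?thesis
    by (simp add: mem_down_set_prod)
qed

lemma left_ideal_ordered_semigroup:
  assumes "left_ideal S mult le K"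
  shows "ordered_semigroup K mult le"
proof -
  note K = left_idealD[OF assms]
  show ?thesis
  proof
    show "reflp_on K le"
      using le_refl K(2) by (rule reflp_on_subset)
    show "antisymp_on K le"
      using le_antisym K(2) by (rule antisymp_on_subset)
    show "transp_on K le"
      using le_trans K(2) by (rule transp_on_subset)
  qed (use K subsetD[OF K(2)] in \<open>simp_all add: assoc mult_mono_left mult_mono_right\<close>)
qed

section \<open>Nil extensions satisfy the two conditions\<close>

lemma nil_extension_spow_le:
  assumes K: "nil_extension S mult le K" "left_simple K mult le" "right_regular K mult le"
    and a: "a \<in> S" and b: "b \<in> S"
  shows "\<exists>n>0. \<exists>s\<in>S. le (spow mult a n) (mult (mult (spow mult a (2 * n)) s) b)"
proof -
  have left: "left_ideal S mult le K" and right: "right_ideal S mult le K"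
    using K(1) by (auto simp: nil_extension_def two_sided_ideal_def)
  note KS = left_idealD(2,3)[OF left]
  interpret K: ordered_semigroup K mult le
    by (rule left_ideal_ordered_semigroup[OF left])
  obtain n where n: "n > 0" "spow mult a n \<in> K"
    using K(1) a unfolding nil_extension_def by blast
  define c where "c = spow mult a n"
  have c: "c \<in> K" "c \<in> S"
    using n KS c_def by auto
  have cb: "mult c b \<in> K"
    using right_ideal_mult[OF right c(1) b] .
  obtain x where x: "x \<in> K" "le c (mult (mult c c) x)"
    using K(3) c unfolding right_regular_def K.RReg_iff by blast
  obtain y where y: "y \<in> K" "le x (mult y (mult c b))"
    using K.left_simple_le_left_multiple[OF K(2) x(1) cb] by blast
  have S: "x \<in> S" "y \<in> S"
    using x y KS by auto
  have "le (mult (mult c c) x) (mult (mult c c) (mult y (mult c b)))"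
    using c S y b by (intro mult_mono_left) (auto simp: closed)
  also have "mult (mult c c) (mult y (mult c b)) = mult (mult (mult c c) (mult y c)) b"
    using c S b by (simp add: assoc closed)
  finally have "le (mult (mult c c) x) (mult (mult (mult c c) (mult y c)) b)" .
  with x(2) have "le c (mult (mult (mult c c) (mult y c)) b)"
    by (rule le_transD) (use c S b in \<open>simp_all add: closed\<close>)
  then have "le (spow mult a n) (mult (mult (spow mult a (2 * n)) (mult y c)) b)"
    using n a by (simp add: c_def spow_double)
  then show ?thesis
    using n(1) closed[OF S(2) c(2)] by blast
qed

lemma nil_extension_left_absorbed:
  assumes K: "nil_extension S mult le K"
    and a: "a \<in> S" and b: "b \<in> S" and le: "le a (mult b a)"
  shows "a \<in> K"
proof -
  have left: "left_ideal S mult le K" and right: "right_ideal S mult le K"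
    using K by (auto simp: nil_extension_def two_sided_ideal_def)
  obtain m where m: "m > 0" "spow mult b m \<in> K"
    using K b unfolding nil_extension_def by blast
  have "mult (spow mult b m) a \<in> K"
    using right_ideal_mult[OF right m(2) a] .
  then show ?thesis
    using left_idealD(4)[OF left a] le_spow_mult[OF a b le m(1)] by blast
qed

end

section \<open>The right regular elements form the kernel\<close>

locale power_regular_ordered_semigroup = ordered_semigroup +
  assumes spow_le:
      "\<lbrakk>a \<in> S; b \<in> S\<rbrakk>
        \<Longrightarrow> \<exists>n>0. \<exists>s\<in>S. le (spow mult a n) (mult (mult (spow mult a (2 * n)) s) b)"
    and absorbed_RReg: "\<lbrakk>a \<in> S; b \<in> RReg S mult le; le a (mult b a)\<rbrakk> \<Longrightarrow> a \<in> RReg S mult le"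
begin

lemma RReg_subset: "RReg S mult le \<subseteq> S"
  by (auto simp: RReg_iff)

lemma spow_in_RReg:
  assumes "a \<in> S"
  shows "\<exists>n>0. spow mult a n \<in> RReg S mult le"
proof -
  obtain n s where n: "n > 0" "s \<in> S"
      "le (spow mult a n) (mult (mult (spow mult a (2 * n)) s) a)"
    using spow_le[OF assms assms] by blast
  then have "le (spow mult a n) (mult (mult (spow mult a n) (spow mult a n)) (mult s a))"
    using assms by (simp add: spow_double assoc closed spow_closed)
  then have "spow mult a n \<in> RReg S mult le"
    unfolding RReg_iff using spow_closed[OF assms] closed[OF n(2) assms] by blast
  with n(1) show ?thesis
    by blast
qed

text \<open>
  The bound on powers is applied to the witness \<open>x\<close> of regularity. Applied to \<open>e\<close> itself it would
  put \<open>b\<close> at the right end of a power of \<open>e\<close>, whereas regularity yields powers of \<open>e\<close> only as left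
  factors, in \<open>e \<le> e\<^sup>n x\<^sup>n\<^sup>-\<^sup>1\<close>; at the right end stand powers of \<open>x\<close>.
\<close>

lemma RReg_below_left_multiple:
  assumes e: "e \<in> RReg S mult le" and b: "b \<in> S"
  shows "\<exists>s\<in>S. le e (mult s b)"
proof -
  obtain x where x: "e \<in> S" "x \<in> S" "le e (mult (mult e e) x)"
    using e by (auto simp: RReg_iff)
  obtain n s where n: "n > 0" "s \<in> S"
      "le (spow mult x n) (mult (mult (spow mult x (2 * n)) s) b)"
    using spow_le[OF x(2) b] by blast
  obtain u where u: "u \<in> S" "le e (mult u (spow mult x n))"
    using le_mult_spow_witness[OF x n(1)] by blast
  let ?w = "mult (spow mult x (2 * n)) s"
  have w: "?w \<in> S"
    using x n by (simp add: closed spow_closed)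
  have "le (mult u (spow mult x n)) (mult u (mult ?w b))"
    using u x n b w by (intro mult_mono_left) (auto simp: closed spow_closed)
  also have "mult u (mult ?w b) = mult (mult u ?w) b"
    using u w b by (simp add: assoc)
  finally have "le (mult u (spow mult x n)) (mult (mult u ?w) b)" .
  with u(2) have "le e (mult (mult u ?w) b)"
    by (rule le_transD) (use u x w b in \<open>simp_all add: closed spow_closed\<close>)
  then show ?thesis
    using closed[OF u(1) w] by blast
qed

text \<open>
  A power of \<open>s\<close> is right regular and still absorbs \<open>a\<close>, which brings the problem into the scope of
  \<open>absorbed_RReg\<close>.
\<close>

lemma left_absorbed_in_RReg:
  assumes "a \<in> S" "s \<in> S" "le a (mult s a)"
  shows "a \<in> RReg S mult le"
  using spow_in_RReg[OF assms(2)] le_spow_mult[OF assms] absorbed_RReg[OF assms(1)] by blast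

lemma below_RReg_in_RReg:
  assumes t: "t \<in> S" and x: "x \<in> RReg S mult le" and "le t x"
  shows "t \<in> RReg S mult le"
proof -
  obtain s where s: "s \<in> S" "le x (mult s t)"
    using RReg_below_left_multiple[OF x t] by blast
  have "le t (mult s t)"
    using \<open>le t x\<close> s(2) by (rule le_transD) (use t s x RReg_subset in \<open>auto intro: closed\<close>)
  with t s(1) show ?thesis
    by (rule left_absorbed_in_RReg)
qed

lemma left_mult_in_RReg:
  assumes s: "s \<in> S" and x: "x \<in> RReg S mult le"
  shows "mult s x \<in> RReg S mult le"
proof -
  have xS: "x \<in> S"
    using x RReg_subset by blast
  obtain u where u: "u \<in> S" "le x (mult u (mult s x))"
    using RReg_below_left_multiple[OF x closed[OF s xS]] by blast
  have "le (mult s x) (mult s (mult u (mult s x)))"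
    using s u xS by (intro mult_mono_left) (auto simp: closed)
  also have "mult s (mult u (mult s x)) = mult (mult s u) (mult s x)"
    using s u xS by (simp add: assoc closed)
  finally show ?thesis
    by (rule left_absorbed_in_RReg[rotated 2]) (simp_all add: s u xS closed)
qed

text \<open>Being absorbed on the left survives multiplication on the right.\<close>

lemma right_mult_in_RReg:
  assumes s: "s \<in> S" and x: "x \<in> RReg S mult le"
  shows "mult x s \<in> RReg S mult le"
proof -
  have xS: "x \<in> S"
    using x RReg_subset by blast
  obtain u where u: "u \<in> S" "le x (mult u x)"
    using RReg_below_left_multiple[OF x xS] by blast
  have "le (mult x s) (mult (mult u x) s)"
    using s u xS by (intro mult_mono_right) (auto simp: closed)
  then have "le (mult x s) (mult u (mult x s))"
    using s u xS by (simp add: assoc)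
  then show ?thesis
    by (rule left_absorbed_in_RReg[rotated 2]) (simp_all add: s u xS closed)
qed

lemma RReg_nil_extension: "nil_extension S mult le (RReg S mult le)"
proof -
  have "RReg S mult le \<noteq> {}"
    using nonempty spow_in_RReg by blast
  then have "two_sided_ideal S mult le (RReg S mult le)"
    unfolding two_sided_ideal_def
    using left_mult_in_RReg right_mult_in_RReg below_RReg_in_RReg RReg_subset
    by (auto intro!: left_idealI right_idealI le_refl)
  then show ?thesis
    using spow_in_RReg by (simp add: nil_extension_def)
qed

lemma RReg_left_ideal: "left_ideal S mult le (RReg S mult le)"
  using RReg_nil_extension by (simp add: nil_extension_def two_sided_ideal_def)

lemma RReg_left_simple: "left_simple (RReg S mult le) mult le"
  unfolding left_simple_def
proof (intro allI impI)
  fix I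
  assume "left_ideal (RReg S mult le) mult le I"
  note I = left_idealD[OF this]
  obtain l where l: "l \<in> I" "l \<in> RReg S mult le" "l \<in> S"
    using I(1,2) RReg_subset by blast
  have "k \<in> I" if k: "k \<in> RReg S mult le" for k
  proof -
    \<comment> \<open>Bounding by \<open>s l\<^sup>2\<close> instead of \<open>s l\<close> leaves a multiplier \<open>s l\<close> inside the kernel,
      where \<open>I\<close> is known to absorb on the left.\<close>
    obtain s where s: "s \<in> S" "le k (mult s (mult l l))"
      using RReg_below_left_multiple[OF k closed[OF l(3,3)]] by blast
    have "mult (mult s l) l \<in> I"
      using I(3) left_mult_in_RReg s l by blast
    then show ?thesis
      using I(4)[OF k] s l by (simp add: assoc)
  qed
  then show "I = RReg S mult le"
    using I(2) by blast
qed

lemma RReg_right_regular: "right_regular (RReg S mult le) mult le"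
proof -
  interpret R: ordered_semigroup "RReg S mult le" mult le
    by (rule left_ideal_ordered_semigroup[OF RReg_left_ideal])
  have "\<exists>z\<in>RReg S mult le. le a (mult (mult a a) z)" if a: "a \<in> RReg S mult le" for a
  proof -
    obtain x where x: "a \<in> S" "x \<in> S" "le a (mult (mult a a) x)"
      using a by (auto simp: RReg_iff)
    \<comment> \<open>The witness \<open>x\<close> need not lie in the kernel, but \<open>a x\<^sup>2\<close> does.\<close>
    have "le (mult (mult a a) x) (mult (mult a (mult (mult a a) x)) x)"
      using x by (intro mult_mono_right mult_mono_left) (auto simp: closed)
    also have "mult (mult a (mult (mult a a) x)) x = mult (mult a a) (mult a (mult x x))"
      using x by (simp add: assoc closed)
    finally have "le (mult (mult a a) x) (mult (mult a a) (mult a (mult x x)))" .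
    with x(3) have "le a (mult (mult a a) (mult a (mult x x)))"
      by (rule le_transD) (use x in \<open>simp_all add: closed\<close>)
    then show ?thesis
      using right_mult_in_RReg[OF closed[OF x(2,2)] a] by blast
  qed
  then show ?thesis
    unfolding right_regular_def R.RReg_iff by blast
qed

end

section \<open>The characterization\<close>

theorem theorem3p1:
  fixes S :: "'a set"
    and mult :: "'a \<Rightarrow> 'a \<Rightarrow> 'a"
    and le :: "'a \<Rightarrow> 'a \<Rightarrow> bool"
  assumes "ordered_semigroup S mult le"
  shows "(\<exists>K. two_sided_ideal S mult le K \<and>
              ordered_semigroup K mult le \<and>
              left_simple K mult le \<and>
              right_regular K mult le \<and>
              nil_extension S mult le K)
     \<longleftrightarrow>
         (\<forall>a\<in>S. \<forall>b\<in>S. \<exists>n>0.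
            spow mult a n
              \<in> down S le (set_prod mult (set_prod mult {spow mult a (2 * n)} S) {b})) \<and>
         (\<forall>a\<in>S. \<forall>b\<in>RReg S mult le.
            le a (mult b a) \<longrightarrow> (\<exists>x\<in>S. le a (mult (spow mult a 2) x)))"
    (is "?nil \<longleftrightarrow> ?power \<and> ?absorb")
proof
  interpret ordered_semigroup S mult le
    by fact
  assume ?nil
  then obtain K where left: "left_ideal S mult le K" and K: "ordered_semigroup K mult le"
      "left_simple K mult le" "right_regular K mult le" "nil_extension S mult le K"
    by (auto simp: two_sided_ideal_def)
  have ?power
    unfolding mem_down_set_prod2 using nil_extension_spow_le[OF K(4,2,3)] spow_closed by blast
  moreover have ?absorb
  proof (intro ballI impI)
    fix a b
    assume "a \<in> S" "b \<in> RReg S mult le" "le a (mult b a)"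
    then have "a \<in> K"
      using nil_extension_left_absorbed[OF K(4)] by (auto simp: RReg_iff)
    then show "\<exists>x\<in>S. le a (mult (spow mult a 2) x)"
      using K(3) left_idealD(2)[OF left] unfolding right_regular_def RReg_def by blast
  qed
  ultimately show "?power \<and> ?absorb" ..
next
  interpret ordered_semigroup S mult le
    by fact
  assume "?power \<and> ?absorb"
  then have power: ?power and absorb: ?absorb
    by blast+
  interpret power_regular_ordered_semigroup S mult le
  proof unfold_locales
    show "\<exists>n>0. \<exists>s\<in>S. le (spow mult a n) (mult (mult (spow mult a (2 * n)) s) b)"
      if "a \<in> S" "b \<in> S" for a b
      using power[unfolded mem_down_set_prod2] that by blast
    show "a \<in> RReg S mult le" if "a \<in> S" "b \<in> RReg S mult le" "le a (mult b a)" for a b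
      using absorb that unfolding RReg_def by blast
  qed
  show ?nil
    using RReg_nil_extension RReg_left_simple RReg_right_regular
      left_ideal_ordered_semigroup[OF RReg_left_ideal]
    by (auto simp: nil_extension_def)
qed

end
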